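(* Let $(P,\preceq)$ be a locally finite lattice, $f:P\to\mathbb{C}$, and let $S=\{x_1,\dots,x_n\}\subseteq P$ be upper-closed up to $\vee S$, indexed so that $x_i\preceq x_j\Rightarrow i\le j$. Then $$\det[S]_f=\prod_{v=1}^n\Psi_{S,f}(x_v)=\prod_{v=1}^n\sum_{x_u\in S,\ x_v\preceq x_u}f(x_u)\mu(x_v,x_u).$$
   Context: $\vee S=x_1\vee\cdots\vee x_n$. $S$ is upper-closed up to $\vee S$ if $x\in S$ whenever $y\in S$, $y\preceq x$ and $x\preceq\vee S$. $[S]_f$ is the $n\times n$ matrix with $(i,j)$ entry $f(x_i\vee x_j)$. $\Psi_{S,f}$ is the function on $S$ defined recursively by $\Psi_{S,f}(x_k)=f(x_k)-\sum_{x_v\in S,\ x_k\prec x_v}\Psi_{S,f}(x_v)$. $\mu$ denotes the Möbius function of $(P,\preceq)$. *)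

theory Defs
  imports Complex_Main "Jordan_Normal_Form.Determinant"
begin

class locally_finite_order = order +
  assumes finite_interval: "finite {a..b}"

class locally_finite_lattice = lattice + locally_finite_order

definition upper_closed_up_to :: "'a::order set \<Rightarrow> 'a \<Rightarrow> bool" where
  "upper_closed_up_to S z \<longleftrightarrow> (\<forall>x y. y \<in> S \<and> y \<le> x \<and> x \<le> z \<longrightarrow> x \<in> S)"

text \<open>Matrix indices start at 0, so the elements are enumerated as \<open>x 0, \<dots>, x (n - 1)\<close>.\<close>
definition join_matrix :: "nat \<Rightarrow> (nat \<Rightarrow> 'a::lattice) \<Rightarrow> ('a \<Rightarrow> complex) \<Rightarrow> complex mat" where
  "join_matrix n x f = mat n n (\<lambda>(i, j). f (sup (x i) (x j)))"

text \<open>The recursion is well-founded only for finite \<open>S\<close>; the value for infinite \<open>S\<close> is a dummy.\<close>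
function Psi :: "'a::order set \<Rightarrow> ('a \<Rightarrow> complex) \<Rightarrow> 'a \<Rightarrow> complex" where
  "Psi S f x = (if finite S then f x - (\<Sum>y \<in> {y \<in> S. x < y}. Psi S f y) else 0)"
  by auto
termination
proof (relation "measure (\<lambda>(S, f, x). card {y \<in> S. x < y})", goal_cases)
  case (2 S f x y)
  then have "{z \<in> S. y < z} \<subset> {z \<in> S. x < z}"
    by auto
  with 2 show ?case
    by (auto intro: psubset_card_mono)
qed simp

declare Psi.simps [simp del]

function mobius :: "'a::locally_finite_order \<Rightarrow> 'a \<Rightarrow> int" where
  "mobius x y =
     (if x = y then 1
      else if x < y then - (\<Sum>z \<in> {z. x \<le> z \<and> z < y}. mobius x z)
      else 0)"
  by auto
termination
proof (relation "measure (\<lambda>(x, y). card {x..y})", goal_cases)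
  case (2 x y z)
  then have "{x..z} \<subseteq> {x..y}" "y \<in> {x..y}" "y \<notin> {x..z}"
    by auto
  then have "{x..z} \<subset> {x..y}"
    by blast
  then show ?case
    by (auto intro: psubset_card_mono finite_interval)
qed simp

declare mobius.simps [simp del]

end

theory Submission imports Defs begin

text \<open>
  The recursion for \<open>\<Psi>\<close> says that \<open>f y\<close> is the sum of \<open>\<Psi>\<close> over the elements of \<open>S\<close> above \<open>y\<close>,
  and upper-closedness puts every join \<open>x i \<squnion> x j\<close> back into \<open>S\<close>. Since an element is above this
  join iff it is above both \<open>x i\<close> and \<open>x j\<close>, the join matrix factors as the order matrix of \<open>S\<close>,
  which is upper unitriangular, times a lower triangular matrix with diagonal \<open>\<Psi> (x v)\<close>. The
  second product formula is Moebius inversion: intervals between elements of \<open>S\<close> stay inside \<open>S\<close>, so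
  the Moebius function of the whole lattice inverts the order relation of \<open>S\<close>.
\<close>

text \<open>The recursion sets \<open>mobius a b\<close> to minus the sum over the half-open
  interval, so for \<open>a < b\<close> the endpoint cancels all other terms.\<close>

lemma sum_mobius_interval:
  fixes a b :: "'a::locally_finite_order"
  assumes "a \<le> b"
  shows "(\<Sum>z\<in>{a..b}. mobius a z) = (if a = b then 1 else 0)"
proof (cases "a = b")
  case True
  then show ?thesis by (simp add: mobius.simps)
next
  case False
  with assms have less: "a < b" by simp
  let ?I = "{z. a \<le> z \<and> z < b}"
  have split: "{a..b} = insert b ?I"
    using assms by (auto simp: order_le_less)
  have "finite ?I"
    by (rule finite_subset[OF _ finite_interval[of a b]]) auto
  then have "(\<Sum>z\<in>{a..b}. mobius a z) = mobius a b + (\<Sum>z\<in>?I. mobius a z)"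
    unfolding split by simp
  also have "mobius a b = - (\<Sum>z\<in>?I. mobius a z)"
    by (subst mobius.simps) (simp add: less False)
  finally show ?thesis using False by simp
qed

lemma sum_Psi_above:
  fixes y :: "'a::order"
  assumes "finite S" "y \<in> S"
  shows "(\<Sum>z\<in>{z \<in> S. y \<le> z}. Psi S f z) = f y"
proof -
  have "{z \<in> S. y \<le> z} = insert y {z \<in> S. y < z}"
    using assms by (auto simp: order_le_less)
  then have "(\<Sum>z\<in>{z \<in> S. y \<le> z}. Psi S f z) = Psi S f y + (\<Sum>z\<in>{z \<in> S. y < z}. Psi S f z)"
    using assms by simp
  also have "Psi S f y = f y - (\<Sum>z\<in>{z \<in> S. y < z}. Psi S f z)"
    using assms by (subst Psi.simps) simp
  finally show ?thesis by simp
qed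

text \<open>Expanding each \<open>f y\<close> by \<open>sum_Psi_above\<close> and swapping the sums
  gives \<open>Psi S f z\<close> the coefficient \<open>\<Sum>y\<in>{a..z}. mobius a y\<close>,
  which vanishes unless \<open>z = a\<close>.\<close>

lemma Psi_eq_sum_mobius:
  fixes S :: "'a::locally_finite_order set"
  assumes fin: "finite S" and a: "a \<in> S"
    and convex: "\<And>b. b \<in> S \<Longrightarrow> {a..b} \<subseteq> S"
  shows "Psi S f a = (\<Sum>y\<in>{y \<in> S. a \<le> y}. f y * of_int (mobius a y))"
proof -
  let ?U = "{y \<in> S. a \<le> y}"
  have "(\<Sum>y\<in>?U. f y * of_int (mobius a y))
      = (\<Sum>y\<in>?U. \<Sum>z\<in>{z \<in> ?U. y \<le> z}. Psi S f z * of_int (mobius a y))"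
  proof (rule sum.cong[OF refl])
    fix y assume y: "y \<in> ?U"
    \<comment> \<open>Anything above \<open>y\<close> is above \<open>a\<close>, so both summation
      variables may range over \<open>?U\<close>, the form in which the sums can be swapped.\<close>
    then have "{z \<in> ?U. y \<le> z} = {z \<in> S. y \<le> z}"
      by auto
    with y show "f y * of_int (mobius a y)
        = (\<Sum>z\<in>{z \<in> ?U. y \<le> z}. Psi S f z * of_int (mobius a y))"
      using sum_Psi_above[OF fin, of y f] by (simp flip: sum_distrib_right)
  qed
  also have "\<dots> = (\<Sum>z\<in>?U. \<Sum>y\<in>{y \<in> ?U. y \<le> z}. Psi S f z * of_int (mobius a y))"
    using fin by (intro sum.swap_restrict) auto
  also have "\<dots> = (\<Sum>z\<in>?U. if z = a then Psi S f a else 0)"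
  proof (rule sum.cong[OF refl])
    fix z assume z: "z \<in> ?U"
    \<comment> \<open>Convexity ensures that no element of the interval is missing, so the full
      Moebius sum appears.\<close>
    then have "{y \<in> ?U. y \<le> z} = {a..z}"
      using convex[of z] by auto
    then have "(\<Sum>y\<in>{y \<in> ?U. y \<le> z}. Psi S f z * of_int (mobius a y))
        = Psi S f z * of_int (\<Sum>y\<in>{a..z}. mobius a y)"
      by (simp add: sum_distrib_left)
    with z show "(\<Sum>y\<in>{y \<in> ?U. y \<le> z}. Psi S f z * of_int (mobius a y))
        = (if z = a then Psi S f a else 0)"
      by (auto simp: sum_mobius_interval)
  qed
  also have "\<dots> = Psi S f a"
    using fin a by (simp add: sum.delta)
  finally show ?thesis by simp
qed

lemma det_join_matrix_eq_prod_Psi: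
  fixes x :: "nat \<Rightarrow> 'a::lattice"
  assumes inj: "inj_on x {..<n}" and S: "S = x ` {..<n}"
    and ord: "\<And>i j. i < n \<Longrightarrow> j < n \<Longrightarrow> x i \<le> x j \<Longrightarrow> i \<le> j"
    and sup: "\<And>a b. a \<in> S \<Longrightarrow> b \<in> S \<Longrightarrow> sup a b \<in> S"
  shows "det (join_matrix n x f) = (\<Prod>v<n. Psi S f (x v))"
proof -
  \<comment> \<open>\<open>E\<close> is the zeta matrix of \<open>S\<close>, and \<open>B\<close> is
    its transpose with row \<open>k\<close> scaled by \<open>Psi S f (x k)\<close>.\<close>
  define E :: "complex mat" where "E = mat n n (\<lambda>(i, k). if x i \<le> x k then 1 else 0)"
  define B where "B = mat n n (\<lambda>(k, j). if x j \<le> x k then Psi S f (x k) else 0)"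
  have carrier: "E \<in> carrier_mat n n" "B \<in> carrier_mat n n"
    by (simp_all add: E_def B_def)
  have "join_matrix n x f = E * B"
  proof (rule eq_matI)
    fix i j assume "i < dim_row (E * B)" "j < dim_col (E * B)"
    then have ij: "i < n" "j < n" using carrier by auto
    have "f (sup (x i) (x j)) = (\<Sum>z\<in>{z \<in> S. sup (x i) (x j) \<le> z}. Psi S f z)"
      using ij S by (intro sum_Psi_above[symmetric] sup) auto
    also have "\<dots> = (\<Sum>z\<in>S. if sup (x i) (x j) \<le> z then Psi S f z else 0)"
      using S by (intro sum.inter_filter) auto
    also have "\<dots> = (\<Sum>k<n. if sup (x i) (x j) \<le> x k then Psi S f (x k) else 0)"
      unfolding S using inj by (simp add: sum.reindex)
    \<comment> \<open>The condition on the join splits into \<open>x i \<le> x k\<close>, tested by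
      \<open>E\<close>, and \<open>x j \<le> x k\<close>, tested by \<open>B\<close>.\<close>
    also have "\<dots> = (\<Sum>k<n. E $$ (i, k) * B $$ (k, j))"
      using ij by (intro sum.cong) (auto simp: E_def B_def)
    also have "\<dots> = (E * B) $$ (i, j)"
      using ij carrier by (auto simp: scalar_prod_def atLeast0LessThan intro!: sum.cong)
    finally show "join_matrix n x f $$ (i, j) = (E * B) $$ (i, j)"
      using ij by (simp add: join_matrix_def)
  qed (simp_all add: join_matrix_def E_def B_def)
  moreover have "det E = 1"
  proof -
    have "upper_triangular E"
    proof (rule upper_triangularI)
      fix i j assume ij: "j < i" "i < dim_row E"
      then have "\<not> x i \<le> x j"
        using ord[of i j] by (auto simp: E_def)
      with ij show "E $$ (i, j) = 0"
        by (simp add: E_def)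
    qed
    then have "det E = prod_list (diag_mat E)"
      using carrier(1) by (rule det_upper_triangular)
    then show ?thesis
      by (simp add: prod_list_diag_prod E_def)
  qed
  moreover have "det B = (\<Prod>v<n. Psi S f (x v))"
  proof -
    have "det B = prod_list (diag_mat B)"
    proof (rule det_lower_triangular[OF _ carrier(2)])
      fix i j assume ij: "i < j" "j < n"
      then have "\<not> x j \<le> x i"
        using ord[of j i] by auto
      with ij show "B $$ (i, j) = 0"
        by (simp add: B_def)
    qed
    then show ?thesis
      by (simp add: prod_list_diag_prod B_def atLeast0LessThan)
  qed
  ultimately show ?thesis
    using det_mult[OF carrier] by simp
qed

theorem theorem4p5:
  fixes f :: "'a::locally_finite_lattice \<Rightarrow> complex"
    and x :: "nat \<Rightarrow> 'a"
    and n :: nat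
    and S :: "'a set"
  assumes "n \<ge> 1"
    and "inj_on x {..<n}"
    and "S = x ` {..<n}"
    and "\<And>i j. i < n \<Longrightarrow> j < n \<Longrightarrow> x i \<le> x j \<Longrightarrow> i \<le> j"
    and "upper_closed_up_to S (Sup_fin S)"
  shows "det (join_matrix n x f) = (\<Prod>v<n. Psi S f (x v))
    \<and> (\<Prod>v<n. Psi S f (x v)) =
        (\<Prod>v<n. \<Sum>y \<in> {y \<in> S. x v \<le> y}. f y * of_int (mobius (x v) y))"
proof -
  have fin: "finite S" using assms(3) by simp
  have below: "a \<le> Sup_fin S" if "a \<in> S" for a
    using fin that by (rule Sup_fin.coboundedI)
  have closed: "b \<in> S" if "a \<in> S" "a \<le> b" "b \<le> Sup_fin S" for a b
    using assms(5) that unfolding upper_closed_up_to_def by blast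
  have "det (join_matrix n x f) = (\<Prod>v<n. Psi S f (x v))"
  proof (rule det_join_matrix_eq_prod_Psi[OF assms(2-4)])
    \<comment> \<open>The join lies above \<open>a\<close> and, as the least upper bound, below
      \<open>Sup_fin S\<close>.\<close>
    show "sup a b \<in> S" if "a \<in> S" "b \<in> S" for a b
      using closed[of a "sup a b"] below that by simp
  qed
  moreover have "Psi S f (x v) = (\<Sum>y \<in> {y \<in> S. x v \<le> y}. f y * of_int (mobius (x v) y))"
    if "v < n" for v
  proof (rule Psi_eq_sum_mobius[OF fin])
    show v: "x v \<in> S" using that assms(3) by simp
    \<comment> \<open>Since \<open>b \<le> Sup_fin S\<close>, the whole interval lies between
      \<open>x v\<close> and \<open>Sup_fin S\<close>.\<close>
    show "{x v..b} \<subseteq> S" if "b \<in> S" for b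
      using closed[OF v] below[OF that] by (auto intro: order_trans)
  qed
  ultimately show ?thesis by simp
qed

end
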